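(* Let $\mathbb{X}$ be a two-dimensional strictly convex real Banach space. Then $\mathbb{X}$ is an inner product space (i.e. its norm is induced by an inner product) if and only if for every $T\in\mathbb{L}(\mathbb{X})$, either (a) or (b) holds: (a) $M_T=m_T=S_{\mathbb{X}}$. (b) $M_T\perp_B m_T$ and $m_T\perp_B M_T$.
   Context: $S_{\mathbb{X}}$ is the unit sphere of $\mathbb{X}$; $\mathbb{L}(\mathbb{X})$ is the space of bounded linear operators from $\mathbb{X}$ to itself. $M_T=\{x\in S_{\mathbb{X}}:\|Tx\|=\|T\|\}$ and $m_T=\{x\in S_{\mathbb{X}}:\|Tx\|=m(T)\}$, where $m(T)=\inf\{\|Tx\|:\|x\|=1\}$. Birkhoff-James orthogonality: $x\perp_B y$ means $\|x+\lambda y\|\ge\|x\|$ for all scalars $\lambda$; for sets, $A\perp_B B$ means $a\perp_B b$ for all $a\in A$, $b\in B$. $\mathbb{X}$ is strictly convex if $\|x+y\|=\|x\|+\|y\|$ with $x\ne0$ implies $y=kx$ for some $k\ge0$. *)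

theory Defs
  imports "HOL-Analysis.Analysis"
begin

definition strictly_convex_space :: "'a::real_normed_vector itself \<Rightarrow> bool" where
  "strictly_convex_space _ \<longleftrightarrow>
     (\<forall>x y :: 'a. norm (x + y) = norm x + norm y \<and> x \<noteq> 0 \<longrightarrow> (\<exists>k\<ge>0. y = k *\<^sub>R x))"

definition inner_product_on :: "('a::real_vector \<Rightarrow> 'a \<Rightarrow> real) \<Rightarrow> bool" where
  "inner_product_on ip \<longleftrightarrow>
     bilinear ip \<and> (\<forall>x y. ip x y = ip y x) \<and> (\<forall>x. x \<noteq> 0 \<longrightarrow> ip x x > 0)"

definition inner_product_space :: "'a::real_normed_vector itself \<Rightarrow> bool" where
  "inner_product_space _ \<longleftrightarrow>
     (\<exists>ip :: 'a \<Rightarrow> 'a \<Rightarrow> real. inner_product_on ip \<and> (\<forall>x. norm x = sqrt (ip x x)))"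

definition bj_orthogonal :: "'a::real_normed_vector \<Rightarrow> 'a \<Rightarrow> bool" where
  "bj_orthogonal x y \<longleftrightarrow> (\<forall>c::real. norm (x + c *\<^sub>R y) \<ge> norm x)"

definition bj_orthogonal_sets :: "'a::real_normed_vector set \<Rightarrow> 'a set \<Rightarrow> bool" where
  "bj_orthogonal_sets A B \<longleftrightarrow> (\<forall>a\<in>A. \<forall>b\<in>B. bj_orthogonal a b)"

definition max_norm_set :: "('a::real_normed_vector \<Rightarrow>\<^sub>L 'b::real_normed_vector) \<Rightarrow> 'a set" where
  "max_norm_set T = {x \<in> sphere 0 1. norm (blinfun_apply T x) = norm T}"

definition min_modulus :: "('a::real_normed_vector \<Rightarrow>\<^sub>L 'b::real_normed_vector) \<Rightarrow> real" where
  "min_modulus T = (INF x\<in>sphere 0 1. norm (blinfun_apply T x))"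

definition min_norm_set :: "('a::real_normed_vector \<Rightarrow>\<^sub>L 'b::real_normed_vector) \<Rightarrow> 'a set" where
  "min_norm_set T = {x \<in> sphere 0 1. norm (blinfun_apply T x) = min_modulus T}"

end

(* If the norm comes from an inner product, x in M_T and y in m_T, then expanding
   |T(x + t y)|^2 <= |T|^2 |x + t y|^2 and |T(y + t x)|^2 >= m(T)^2 |y + t x|^2 to first order in t gives
   <Tx, Ty> = |T|^2 <x, y> = m(T)^2 <x, y>. So <x, y> = 0 unless |T| = m(T).

   Conversely, strict convexity makes left Birkhoff-James orthogonality to a given vector unique up to
   scalars, so M_T is either the whole sphere or contained in some {x, -x}. A perturbation
   argument then shows that an operator of norm at most 1 which maximises the determinant among those
   mapping span u to span v is a multiple of an isometry; hence the isometries act transitively on the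
   unit sphere. The quadratic form of the Loewner ellipse of the unit ball is unique, hence invariant
   under isometries, hence constant on the unit sphere. *)
theory Submission
  imports Defs
begin

section \<open>Coordinates in a two-dimensional normed space\<close>

text \<open>The pair \<open>f\<close>, \<open>g\<close> is the dual basis of \<open>u\<close>,
  \<open>w\<close>; through it operators and quadratic forms on the plane become tuples of
  reals.\<close>

definition plane_coords ::
    "'a::real_normed_vector \<Rightarrow> 'a \<Rightarrow> ('a \<Rightarrow> real) \<Rightarrow> ('a \<Rightarrow> real) \<Rightarrow> bool" where
  "plane_coords u w f g \<longleftrightarrow>
     linear f \<and> linear g \<and> (\<forall>z. z = f z *\<^sub>R u + g z *\<^sub>R w) \<and>
     f u = 1 \<and> f w = 0 \<and> g u = 0 \<and> g w = 1"

lemma plane_coords_expand: "plane_coords u w f g \<Longrightarrow> f z *\<^sub>R u + g z *\<^sub>R w = z"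
  unfolding plane_coords_def by metis

lemma plane_coords_lincomb:
  assumes "plane_coords u w f g"
  shows "f (a *\<^sub>R u + b *\<^sub>R w) = a" "g (a *\<^sub>R u + b *\<^sub>R w) = b"
  using assms unfolding plane_coords_def by (simp_all add: linear_add linear_scale)

lemma ex_plane_coords:
  fixes u :: "'a::real_normed_vector"
  assumes dim: "dim (UNIV :: 'a set) = 2" and u: "u \<noteq> 0"
  obtains w f g where "plane_coords u w f g"
proof -
  have "independent {u}" using u by simp
  from maximal_independent_subset_extend[OF subset_UNIV this]
  obtain B where B: "{u} \<subseteq> B" "B \<subseteq> UNIV" "independent B" "UNIV \<subseteq> span B" .
  then have "span B = UNIV" by blast
  have "card B = 2"
    using B(3) dim dim_eq_card[of B UNIV] \<open>span B = UNIV\<close> by simp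
  then obtain w where w: "B = {u, w}" "u \<noteq> w"
    using B(1) by (auto simp: card_2_iff)
  define f where "f z = representation B z u" for z
  define g where "g z = representation B z w" for z
  have lf: "linear f" and lg: "linear g"
    unfolding f_def g_def using B(3) \<open>span B = UNIV\<close>
    by (auto intro!: linearI simp: representation_add representation_scale)
  have ex: "z = f z *\<^sub>R u + g z *\<^sub>R w" for z
  proof -
    have "(\<Sum>b\<in>B. representation B z b *\<^sub>R b) = z"
      using B(3) \<open>span B = UNIV\<close> w by (intro sum_representation_eq) auto
    then show ?thesis using w by (simp add: f_def g_def)
  qed
  have "f u = 1" "f w = 0" "g u = 0" "g w = 1"
    unfolding f_def g_def using B(3) w by (simp_all add: representation_basis)
  then have "plane_coords u w f g"
    using lf lg ex unfolding plane_coords_def by blast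
  then show thesis by (rule that)
qed

text \<open>On the Euclidean unit circle the norm attains a minimum, positive because
  \<open>u\<close> and \<open>w\<close> are independent; homogeneity does the rest. The constant
  gives bounded coordinates, a compact sphere and, later, starting points for two
  maximisations.\<close>

lemma plane_coords_bounded:
  fixes u :: "'a::real_normed_vector"
  assumes c: "plane_coords u w f g"
  obtains m where "0 < m" "\<And>a b. m * norm (a, b) \<le> norm (a *\<^sub>R u + b *\<^sub>R w)"
proof -
  have "compact (sphere (0::real \<times> real) 1)" by simp
  moreover have "sphere (0::real \<times> real) 1 \<noteq> {}" 
    by (auto intro!: exI[of _ "1::real"] exI[of _ "0::real"] simp: norm_prod_def)
  moreover have "continuous_on (sphere (0::real \<times> real) 1)
      (\<lambda>p. norm (fst p *\<^sub>R u + snd p *\<^sub>R w))"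
    by (intro continuous_intros)
  ultimately obtain p where p: "p \<in> sphere (0::real \<times> real) 1"
    "\<And>q. q \<in> sphere 0 1 \<Longrightarrow>
       norm (fst p *\<^sub>R u + snd p *\<^sub>R w) \<le> norm (fst q *\<^sub>R u + snd q *\<^sub>R w)"
    by (metis (no_types, lifting) continuous_attains_inf)
  define m where "m = norm (fst p *\<^sub>R u + snd p *\<^sub>R w)"
  have "fst p *\<^sub>R u + snd p *\<^sub>R w \<noteq> 0"
  proof
    assume 0: "fst p *\<^sub>R u + snd p *\<^sub>R w = 0"
    have "f 0 = 0" "g 0 = 0" using c by (simp_all add: plane_coords_def linear_0)
    then have "p = 0"
      using plane_coords_lincomb[OF c, of "fst p" "snd p"] unfolding 0 by (simp add: prod_eq_iff)
    then show False using p(1) by simp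
  qed
  then have "0 < m" by (simp add: m_def)
  moreover have "m * norm (a, b) \<le> norm (a *\<^sub>R u + b *\<^sub>R w)" for a b
  proof (cases "(a, b) = 0")
    case False
    define r where "r = norm (a, b)"
    have r: "r > 0" using False by (simp add: r_def)
    have "(a / r, b / r) = (1 / r) *\<^sub>R (a, b)" by simp
    then have "norm (a / r, b / r) = 1"
      using r unfolding r_def by (metis False norm_sgn sgn_div_norm inverse_eq_divide)
    then have "m \<le> norm ((a / r) *\<^sub>R u + (b / r) *\<^sub>R w)"
      using p(2)[of "(a / r, b / r)"] by (simp add: m_def)
    also have "(a / r) *\<^sub>R u + (b / r) *\<^sub>R w = (1 / r) *\<^sub>R (a *\<^sub>R u + b *\<^sub>R w)"
      by (simp add: scaleR_add_right)
    also have "norm \<dots> = norm (a *\<^sub>R u + b *\<^sub>R w) / r"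
      using r by simp
    finally show ?thesis using r unfolding r_def[symmetric]
      by (simp add: pos_le_divide_eq)
  qed simp
  ultimately show thesis by (rule that)
qed

lemma plane_coords_bounded_linear:
  assumes c: "plane_coords u w f g"
  shows "bounded_linear f" "bounded_linear g"
proof -
  obtain m where m: "0 < m" "\<And>a b. m * norm (a, b) \<le> norm (a *\<^sub>R u + b *\<^sub>R w)"
    using plane_coords_bounded[OF c] by blast
  have le: "norm (f z, g z) \<le> norm z * (1 / m)" for z
    using m(2)[of "f z" "g z"] m(1) plane_coords_expand[OF c, of z] by (simp add: field_simps)
  have "norm (f z) \<le> norm z * (1 / m)" "norm (g z) \<le> norm z * (1 / m)" for z
    using le[of z] norm_fst_le[of "f z" "g z"] norm_snd_le[of "g z" "f z"] by linarith+
  moreover have "linear f" "linear g" using c by (simp_all add: plane_coords_def)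
  ultimately show "bounded_linear f" "bounded_linear g"
    by (auto intro!: bounded_linear.intro bounded_linear_axioms.intro exI[of _ "1 / m"])
qed

lemma plane_coords_blinfun:
  fixes u :: "'a::real_normed_vector"
  assumes c: "plane_coords u w f g"
  obtains T :: "'a \<Rightarrow>\<^sub>L 'b::real_normed_vector"
  where "\<And>z. blinfun_apply T z = f z *\<^sub>R p + g z *\<^sub>R q"
proof -
  have "bounded_linear (\<lambda>z. f z *\<^sub>R p + g z *\<^sub>R q)"
    using plane_coords_bounded_linear[OF c]
    by (intro bounded_linear_add bounded_linear_scaleR_const)
  then show thesis using that[of "Blinfun (\<lambda>z. f z *\<^sub>R p + g z *\<^sub>R q)"]
    by (simp add: bounded_linear_Blinfun_apply)
qed

text \<open>The sphere is the continuous image of its coordinate set \<open>S\<close>, which is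
  closed in the Euclidean plane and bounded by \<open>1 / m\<close>.\<close>

lemma compact_unit_sphere_plane:
  assumes "dim (UNIV :: 'a::real_normed_vector set) = 2"
  shows "compact (sphere (0::'a) 1)" "sphere (0::'a) 1 \<noteq> {}"
proof -
  have "\<exists>u::'a. u \<noteq> 0"
  proof (rule ccontr)
    assume "\<nexists>u::'a. u \<noteq> 0"
    then have "(UNIV :: 'a set) \<subseteq> span {}" by auto
    then have "dim (UNIV :: 'a set) \<le> card ({} :: 'a set)" by (rule dim_le_card) simp
    then show False using assms by simp
  qed
  then obtain u :: 'a where u: "u \<noteq> 0" by blast
  then have "sgn u \<in> sphere 0 1" by (simp add: norm_sgn)
  then show "sphere (0::'a) 1 \<noteq> {}" by blast
  obtain w f g where c: "plane_coords u w f g" using ex_plane_coords[OF assms u] .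
  obtain m where m: "0 < m" "\<And>a b. m * norm (a, b) \<le> norm (a *\<^sub>R u + b *\<^sub>R w)"
    using plane_coords_bounded[OF c] by blast
  define S where "S = {p. norm (fst p *\<^sub>R u + snd p *\<^sub>R w) = 1}"
  have "closed S" unfolding S_def by (intro closed_Collect_eq continuous_intros)
  moreover have "bounded S"
  proof (rule boundedI)
    fix p assume "p \<in> S"
    then show "norm p \<le> 1 / m"
      using m(2)[of "fst p" "snd p"] m(1) by (simp add: S_def field_simps)
  qed
  ultimately have "compact S" by (simp add: compact_eq_bounded_closed)
  then have "compact ((\<lambda>p. fst p *\<^sub>R u + snd p *\<^sub>R w) ` S)"
    by (intro compact_continuous_image continuous_intros)
  moreover have "(\<lambda>p. fst p *\<^sub>R u + snd p *\<^sub>R w) ` S = sphere 0 1"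
  proof
    show "sphere 0 1 \<subseteq> (\<lambda>p. fst p *\<^sub>R u + snd p *\<^sub>R w) ` S"
    proof
      fix z :: 'a assume "z \<in> sphere 0 1"
      then show "z \<in> (\<lambda>p. fst p *\<^sub>R u + snd p *\<^sub>R w) ` S"
        using plane_coords_expand[OF c, of z]
        by (intro image_eqI[of _ _ "(f z, g z)"]) (auto simp: S_def)
    qed
  qed (auto simp: S_def)
  ultimately show "compact (sphere (0::'a) 1)" by simp
qed

section \<open>The minimum modulus and its attainment\<close>

lemma min_modulus_le:
  assumes "norm x = 1"
  shows "min_modulus T \<le> norm (blinfun_apply T x)"
  unfolding min_modulus_def using assms
  by (intro cINF_lower bdd_belowI2[of _ 0]) auto

lemma min_modulus_mult_le: "min_modulus T * norm z \<le> norm (blinfun_apply T z)"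
proof (cases "z = 0")
  case False
  then have "min_modulus T \<le> norm (blinfun_apply T (sgn z))"
    by (intro min_modulus_le) (simp add: norm_sgn)
  also have "\<dots> = norm (blinfun_apply T z) / norm z"
    by (simp add: sgn_div_norm blinfun.scaleR_right divide_inverse_commute)
  finally show ?thesis using False by (simp add: field_simps)
qed simp

lemma min_norm_set_nonempty:
  assumes "dim (UNIV :: 'a::real_normed_vector set) = 2"
  shows "min_norm_set (T :: 'a \<Rightarrow>\<^sub>L 'b::real_normed_vector) \<noteq> {}"
proof -
  have "continuous_on (sphere 0 1) (\<lambda>z. norm (blinfun_apply T z))"
    by (intro continuous_intros)
  then obtain y where y: "y \<in> sphere 0 1"
    "\<And>z. z \<in> sphere 0 1 \<Longrightarrow> norm (blinfun_apply T y) \<le> norm (blinfun_apply T z)"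
    using continuous_attains_inf[OF compact_unit_sphere_plane[OF assms]] by blast
  then have "norm (blinfun_apply T y) \<le> min_modulus T"
    unfolding min_modulus_def by (intro cINF_greatest) auto
  then show ?thesis using y(1) min_modulus_le[of y T]
    by (auto simp: min_norm_set_def)
qed

section \<open>Birkhoff-James orthogonality under strict convexity\<close>

lemma bj_orthogonal_not_parallel:
  assumes "bj_orthogonal x y" "x \<noteq> 0"
  shows "x \<noteq> c *\<^sub>R y"
  using assms unfolding bj_orthogonal_def
  by (metis add.right_inverse norm_le_zero_iff norm_zero scaleR_minus_left)

text \<open>Both vectors being orthogonal to \<open>y\<close> forces \<open>x'\<close> to be, up to
  sign, a unit vector \<open>x + d *\<^sub>R y\<close>. All points of the line through
  \<open>x\<close> in direction \<open>y\<close> have norm at least 1, and strict convexity lets the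
  unit ball touch such a line only once.\<close>

lemma bj_orthogonal_left_unique:
  fixes x x' y :: "'a::real_normed_vector"
  assumes dim: "dim (UNIV :: 'a set) = 2" and sc: "strictly_convex_space TYPE('a)"
    and x: "norm x = 1" "bj_orthogonal x y" and x': "norm x' = 1" "bj_orthogonal x' y"
    and y: "y \<noteq> 0"
  shows "x' = x \<or> x' = - x"
proof -
  obtain w f g where c: "plane_coords y w f g" using ex_plane_coords[OF dim y] .
  have ex: "z = f z *\<^sub>R y + g z *\<^sub>R w" for z using plane_coords_expand[OF c, of z] by simp
  have "g x \<noteq> 0" using ex[of x] bj_orthogonal_not_parallel[OF x(2)] x(1) by force
  define al where "al = g x' / g x"
  define be where "be = f x' - al * f x"
  have eq: "x' = al *\<^sub>R x + be *\<^sub>R y"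
  proof -
    have "al *\<^sub>R x + be *\<^sub>R y = al *\<^sub>R (f x *\<^sub>R y + g x *\<^sub>R w) + be *\<^sub>R y" using ex[of x] by simp
    also have "\<dots> = f x' *\<^sub>R y + g x' *\<^sub>R w"
      using \<open>g x \<noteq> 0\<close> by (simp add: al_def be_def algebra_simps)
    finally show ?thesis using ex[of x'] by simp
  qed
  have "al \<noteq> 0" using eq bj_orthogonal_not_parallel[OF x'(2), of be] x'(1) by force
  \<comment> \<open>Here \<open>x' - be *\<^sub>R y\<close> is \<open>al *\<^sub>R x\<close>, so
    orthogonality of \<open>x'\<close> bounds \<open>\<bar>al\<bar>\<close> from below;
    orthogonality of \<open>x\<close> bounds it from above.\<close>
  have "norm (x' + (- be) *\<^sub>R y) \<ge> 1" using x' unfolding bj_orthogonal_def by metis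
  then have 1: "\<bar>al\<bar> \<ge> 1" using x(1) by (simp add: eq)
  have xc: "norm (x + c *\<^sub>R y) \<ge> 1" for c using x unfolding bj_orthogonal_def by metis
  define d where "d = be / al"
  have xd: "x' = al *\<^sub>R (x + d *\<^sub>R y)" using \<open>al \<noteq> 0\<close> by (simp add: eq d_def scaleR_add_right)
  then have nd: "\<bar>al\<bar> * norm (x + d *\<^sub>R y) = 1" using x'(1) by simp
  have al: "\<bar>al\<bar> = 1"
    using 1 xc[of d] nd mult_left_mono[OF xc[of d], of "\<bar>al\<bar>"] by simp
  then have nd1: "norm (x + d *\<^sub>R y) = 1" using nd by simp
  \<comment> \<open>The midpoint of the two unit vectors is again on the line, so equality holds in
    the triangle inequality.\<close>
  have "x + (x + d *\<^sub>R y) = 2 *\<^sub>R (x + (d / 2) *\<^sub>R y)" by (simp add: scaleR_add_right scaleR_2)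
  then have "norm (x + (x + d *\<^sub>R y)) \<ge> 2" using xc[of "d / 2"] by simp
  then have "norm (x + (x + d *\<^sub>R y)) = norm x + norm (x + d *\<^sub>R y)"
    using norm_triangle_ineq[of x "x + d *\<^sub>R y"] nd1 x(1) by simp
  moreover have "x \<noteq> 0" using x(1) by auto
  ultimately obtain k where k: "k \<ge> 0" "x + d *\<^sub>R y = k *\<^sub>R x"
    using sc unfolding strictly_convex_space_def by blast
  then have "k = 1" using nd1 x(1) by simp
  then have "x' = al *\<^sub>R x" using k xd by simp
  then show ?thesis using al by (auto simp: abs_if split: if_splits)
qed

text \<open>Fix one \<open>y\<close> in the nonempty \<open>min_norm_set T\<close>: every element of
  \<open>max_norm_set T\<close> is orthogonal to it, and such unit vectors agree up to sign.\<close>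

lemma max_norm_set_dichotomy:
  fixes T :: "'a::real_normed_vector \<Rightarrow>\<^sub>L 'a"
  assumes dim: "dim (UNIV :: 'a set) = 2" and sc: "strictly_convex_space TYPE('a)"
    and T: "max_norm_set T = sphere 0 1 \<or> bj_orthogonal_sets (max_norm_set T) (min_norm_set T)"
  shows "max_norm_set T = sphere 0 1 \<or> (\<exists>x. norm x = 1 \<and> max_norm_set T \<subseteq> {x, - x})"
proof (cases "max_norm_set T = sphere 0 1 \<or> max_norm_set T = {}")
  case True
  then show ?thesis using compact_unit_sphere_plane(2)[OF dim] by auto
next
  case False
  obtain y where y: "y \<in> min_norm_set T" using min_norm_set_nonempty[OF dim] by blast
  then have "y \<noteq> 0" by (auto simp: min_norm_set_def)
  have orth: "norm z = 1 \<and> bj_orthogonal z y" if "z \<in> max_norm_set T" for z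
    using that T False y by (auto simp: bj_orthogonal_sets_def max_norm_set_def)
  obtain x where x: "x \<in> max_norm_set T" using False by blast
  have "max_norm_set T \<subseteq> {x, - x}"
    using bj_orthogonal_left_unique[OF dim sc] orth x \<open>y \<noteq> 0\<close> by blast
  then show ?thesis using orth[OF x] by blast
qed

section \<open>Perturbing an operator that attains its norm at one pair of points\<close>

text \<open>Near \<open>x\<close> convexity makes \<open>z + t K z\<close> shorter than \<open>z\<close> for all small \<open>t\<close> at once, so no
  smoothness of the norm is needed; away from \<open>x\<close> there is room because the norm of \<open>T\<close> is not attained.\<close>
lemma perturb_norm_le_1:
  fixes T K :: "'a::real_normed_vector \<Rightarrow>\<^sub>L 'a"
  assumes dim: "dim (UNIV :: 'a set) = 2"
    and T: "norm T \<le> 1" "max_norm_set T \<subseteq> {x, - x}"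
    and K: "norm (x + blinfun_apply K x) < 1"
  obtains t where "0 < t" "t \<le> 1"
    "\<And>z. norm (blinfun_apply T (z + t *\<^sub>R blinfun_apply K z)) \<le> norm z"
proof -
  \<comment> \<open>\<open>F\<close> collects the unit vectors that \<open>I + K\<close> does not
    shorten. It misses \<open>x\<close> and \<open>- x\<close>, so on this compact set
    \<open>T\<close> stays below 1 by a uniform gap \<open>e\<close>.\<close>
  define F where "F = sphere 0 1 \<inter> {z. 1 \<le> norm (z + blinfun_apply K z)}"
  have "closed {z. 1 \<le> norm (z + blinfun_apply K z)}"
    by (intro closed_Collect_le continuous_intros)
  then have F: "compact F" unfolding F_def
    using compact_unit_sphere_plane(1)[OF dim] by (rule compact_Int_closed[rotated])
  have lt: "norm (blinfun_apply T z) < 1" if "z \<in> F" for z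
  proof (rule ccontr)
    assume "\<not> ?thesis"
    moreover have "norm (blinfun_apply T z) \<le> norm T"
      using norm_blinfun[of T z] that by (simp add: F_def)
    ultimately have "z \<in> max_norm_set T" using T(1) that by (auto simp: F_def max_norm_set_def)
    then have "z = x \<or> z = - x" using T(2) by blast
    moreover have "norm (- x + blinfun_apply K (- x)) = norm (x + blinfun_apply K x)"
      by (metis blinfun.minus_right minus_add_distrib norm_minus_cancel)
    ultimately show False using that K by (auto simp: F_def)
  qed
  obtain e where e: "e > 0" "\<And>z. z \<in> F \<Longrightarrow> norm (blinfun_apply T z) \<le> 1 - e"
  proof (cases "F = {}")
    case True
    then show thesis using that[of 1] by auto
  next
    case False
    have "continuous_on F (\<lambda>z. norm (blinfun_apply T z))"
      by (intro continuous_intros)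
    with False obtain y where y: "y \<in> F"
      "\<And>z. z \<in> F \<Longrightarrow> norm (blinfun_apply T z) \<le> norm (blinfun_apply T y)"
      using continuous_attains_sup[OF F] by blast
    then show thesis using that[of "1 - norm (blinfun_apply T y)"] lt by auto
  qed
  \<comment> \<open>The bound 1 makes \<open>z + t *\<^sub>R K z\<close> a convex combination of
    \<open>z\<close> and \<open>z + K z\<close>, which serves outside \<open>F\<close>. The quotient
    keeps \<open>t * norm K\<close> within the gap \<open>e\<close>, which serves on
    \<open>F\<close>; its added 1 avoids division by zero.\<close>
  define t where "t = min 1 (e / (norm K + 1))"
  have K1: "norm K + 1 > 0" using norm_ge_zero[of K] by linarith
  then have t: "0 < t" "t \<le> 1" using e(1) by (auto simp: t_def)
  have "t \<le> e / (norm K + 1)" by (simp add: t_def)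
  then have "t * (norm K + 1) \<le> e" using K1 by (simp add: pos_le_divide_eq)
  then have tK: "t * norm K \<le> e" using t by (simp add: algebra_simps)
  have Tz: "norm (blinfun_apply T z) \<le> norm z" for z
    using norm_blinfun[of T z] T(1) mult_right_mono[of "norm T" 1 "norm z"] by simp
  have unit: "norm (blinfun_apply T (z + t *\<^sub>R blinfun_apply K z)) \<le> 1" if z: "norm z = 1" for z
  proof (cases "z \<in> F")
    case True
    have "norm (blinfun_apply T (z + t *\<^sub>R blinfun_apply K z))
        \<le> norm (blinfun_apply T z) + norm (blinfun_apply T (t *\<^sub>R blinfun_apply K z))"
      by (simp add: blinfun.add_right norm_triangle_ineq)
    also have "\<dots> \<le> (1 - e) + norm (t *\<^sub>R blinfun_apply K z)"
      by (intro add_mono e(2) True Tz)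
    also have "\<dots> \<le> (1 - e) + t * norm K"
      using norm_blinfun[of K z] z t by simp
    also have "\<dots> \<le> 1" using tK by simp
    finally show ?thesis .
  next
    case False
    have "norm (blinfun_apply T (z + t *\<^sub>R blinfun_apply K z)) \<le> norm (z + t *\<^sub>R blinfun_apply K z)"
      by (rule Tz)
    also have "\<dots> = norm ((1 - t) *\<^sub>R z + t *\<^sub>R (z + blinfun_apply K z))"
      by (simp add: algebra_simps)
    also have "\<dots> \<le> (1 - t) * norm z + t * norm (z + blinfun_apply K z)"
      using t by (intro order_trans[OF norm_triangle_ineq]) simp
    also have "\<dots> \<le> (1 - t) * 1 + t * 1"
      using False z t by (intro add_mono mult_left_mono) (auto simp: F_def)
    finally show ?thesis by simp
  qed
  have "norm (blinfun_apply T (z + t *\<^sub>R blinfun_apply K z)) \<le> norm z" for z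
  proof (cases "z = 0")
    case False
    have "z + t *\<^sub>R blinfun_apply K z = norm z *\<^sub>R (sgn z + t *\<^sub>R blinfun_apply K (sgn z))"
      using False by (simp add: sgn_div_norm blinfun.scaleR_right algebra_simps)
    then have "norm (blinfun_apply T (z + t *\<^sub>R blinfun_apply K z))
        = norm z * norm (blinfun_apply T (sgn z + t *\<^sub>R blinfun_apply K (sgn z)))"
      by (simp add: blinfun.scaleR_right)
    also have "\<dots> \<le> norm z * 1"
      using unit[of "sgn z"] False by (intro mult_left_mono) (simp_all add: norm_sgn)
    finally show ?thesis by simp
  qed simp
  then show thesis using t by (intro that)
qed

section \<open>Inner product norms satisfy the orthogonality condition\<close>

text \<open>A nonnegative quadratic form that vanishes at a vector has that vector in its kernel.
  This applies to \<open>M\<^sup>2 * ip z z - ip (T z) (T z)\<close> at \<open>x\<close> and to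
  \<open>ip (T z) (T z) - m\<^sup>2 * ip z z\<close> at \<open>y\<close>.\<close>

lemma inner_product_space_orthogonal:
  fixes T :: "'a::real_normed_vector \<Rightarrow>\<^sub>L 'a"
  assumes ip: "inner_product_on ip" "\<And>x::'a. norm x = sqrt (ip x x)"
    and x: "x \<in> max_norm_set T" and y: "y \<in> min_norm_set T"
    and ne: "min_modulus T \<noteq> norm T"
  shows "ip x y = 0"
proof -
  define M where "M = norm T"
  define m where "m = min_modulus T"
  have bil: "bilinear ip" and sym: "ip v w = ip w v" for v w
    using ip(1) by (auto simp: inner_product_on_def)
  have nn: "ip z z = (norm z)\<^sup>2" for z
  proof -
    have "ip z z \<ge> 0"
      using ip(1) bilinear_lzero[OF bil] by (cases "z = 0") (auto simp: inner_product_on_def intro: less_imp_le)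
    then show ?thesis using ip(2)[of z] by simp
  qed
  have sq: "ip (v + t *\<^sub>R w) (v + t *\<^sub>R w) = ip v v + 2 * t * ip v w + t\<^sup>2 * ip w w" for v w t
    by (simp add: bilinear_ladd[OF bil] bilinear_radd[OF bil] bilinear_lmul[OF bil]
        bilinear_rmul[OF bil] sym[of w v] power2_eq_square algebra_simps)
  have m0: "m \<ge> 0" unfolding m_def using y norm_ge_zero[of "T y"] by (auto simp: min_norm_set_def)
  have x': "ip x x = 1" "ip (T x) (T x) = M\<^sup>2" using x by (auto simp: max_norm_set_def nn M_def)
  have y': "ip y y = 1" "ip (T y) (T y) = m\<^sup>2" using y by (auto simp: min_norm_set_def nn m_def)
  have up: "ip (T z) (T z) \<le> M\<^sup>2 * ip z z" for z
    using power_mono[OF norm_blinfun[of T z], of 2] by (simp add: nn M_def power_mult_distrib)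
  have low: "m\<^sup>2 * ip z z \<le> ip (T z) (T z)" for z
    using power_mono[OF min_modulus_mult_le[of T z], of 2] m0 by (simp add: nn m_def power_mult_distrib)
  have lin0: "p = 0" if "\<And>t::real. t * p \<le> t\<^sup>2 * c" for p c :: real
  proof (rule ccontr)
    assume "p \<noteq> 0"
    \<comment> \<open>With \<open>k > c\<close>, the choice \<open>t = p / k\<close> lets the linear
      term exceed the quadratic one.\<close>
    define k where "k = \<bar>c\<bar> + 1"
    have k: "k > 0" "c < k" by (auto simp: k_def)
    have "(p / k) * p \<le> (p / k)\<^sup>2 * c" by (rule that)
    then have "p\<^sup>2 * k \<le> p\<^sup>2 * c" using k by (simp add: field_simps power2_eq_square)
    then show False using \<open>p \<noteq> 0\<close> k by simp
  qed
  have "2 * (ip (T x) (T y) - M\<^sup>2 * ip x y) = 0"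
  proof (rule lin0)
    fix t
    show "t * (2 * (ip (T x) (T y) - M\<^sup>2 * ip x y)) \<le> t\<^sup>2 * (M\<^sup>2 - m\<^sup>2)"
      using up[of "x + t *\<^sub>R y"] by (simp add: blinfun.add_right blinfun.scaleR_right sq x' y' algebra_simps)
  qed
  moreover have "2 * (m\<^sup>2 * ip x y - ip (T x) (T y)) = 0"
  proof (rule lin0)
    fix t
    show "t * (2 * (m\<^sup>2 * ip x y - ip (T x) (T y))) \<le> t\<^sup>2 * (M\<^sup>2 - m\<^sup>2)"
      using low[of "y + t *\<^sub>R x"]
      by (simp add: blinfun.add_right blinfun.scaleR_right sq x' y' sym[of y x] sym[of "T y" "T x"] algebra_simps)
  qed
  ultimately have "(M\<^sup>2 - m\<^sup>2) * ip x y = 0" by (auto simp: algebra_simps)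
  moreover have "M\<^sup>2 \<noteq> m\<^sup>2" using m0 ne by (simp add: M_def m_def)
  ultimately show ?thesis by simp
qed

lemma inner_product_space_bj_orthogonal:
  fixes x :: "'a::real_normed_vector"
  assumes ip: "inner_product_on ip" "\<And>x::'a. norm x = sqrt (ip x x)" and "ip x y = 0"
  shows "bj_orthogonal x y"
proof -
  have bil: "bilinear ip" and sym: "ip y x = ip x y"
    using ip(1) by (auto simp: inner_product_on_def)
  have "ip y y \<ge> 0"
    using ip(1) bilinear_lzero[OF bil] by (cases "y = 0") (auto simp: inner_product_on_def intro: less_imp_le)
  moreover have "ip (x + c *\<^sub>R y) (x + c *\<^sub>R y) = ip x x + c\<^sup>2 * ip y y" for c
    using assms(3) sym by (simp add: bilinear_ladd[OF bil] bilinear_radd[OF bil] bilinear_lmul[OF bil]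
        bilinear_rmul[OF bil] power2_eq_square algebra_simps)
  ultimately show ?thesis unfolding bj_orthogonal_def by (simp add: ip(2))
qed

text \<open>Alternative (a) arises when \<open>min_modulus T = norm T\<close>, since
  \<open>T\<close> then scales all vectors equally; otherwise (b) holds.\<close>

lemma inner_product_space_imp_orthogonal_sets:
  fixes T :: "'a::real_normed_vector \<Rightarrow>\<^sub>L 'a"
  assumes "inner_product_space TYPE('a)"
  shows "(max_norm_set T = sphere 0 1 \<and> min_norm_set T = sphere 0 1) \<or>
     (bj_orthogonal_sets (max_norm_set T) (min_norm_set T) \<and>
      bj_orthogonal_sets (min_norm_set T) (max_norm_set T))"
proof (cases "min_modulus T = norm T")
  case True
  have "norm (T z) = norm T" if "norm z = 1" for z
    using norm_blinfun[of T z] min_modulus_le[OF that, of T] that True by simp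
  then show ?thesis using True by (auto simp: max_norm_set_def min_norm_set_def)
next
  case False
  obtain ip :: "'a \<Rightarrow> 'a \<Rightarrow> real" where ip: "inner_product_on ip" "\<And>x. norm x = sqrt (ip x x)"
    using assms by (auto simp: inner_product_space_def)
  have "ip x y = 0" "ip y x = 0" if "x \<in> max_norm_set T" "y \<in> min_norm_set T" for x y
    using inner_product_space_orthogonal[OF ip that False] ip(1) by (auto simp: inner_product_on_def)
  then show ?thesis
    using inner_product_space_bj_orthogonal[OF ip] by (simp add: bj_orthogonal_sets_def)
qed

section \<open>Transitivity of the isometries on the unit sphere\<close>

text \<open>Among the operators with \<open>u \<mapsto> \<alpha> v\<close>, \<open>w \<mapsto> \<gamma> v + \<beta> y\<close> of norm at most 1, encoded as
  \<open>(\<alpha>, \<beta>, \<gamma>)\<close>, one that maximises \<open>\<alpha> \<beta>\<close> is a multiple of an isometry: otherwise its norm is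
  attained at most at \<open>\<plusminus> x\<close>, and it can be improved by composing with \<open>I + t K\<close>, where \<open>K\<close> is upper
  triangular with \<open>K x = - x / 2\<close> and has positive trace.\<close>
lemma ex_isometry_between_unit_vectors:
  fixes u v :: "'a::real_normed_vector"
  assumes dim: "dim (UNIV :: 'a set) = 2" and sc: "strictly_convex_space TYPE('a)"
    and H: "\<And>T :: 'a \<Rightarrow>\<^sub>L 'a. max_norm_set T = sphere 0 1 \<or>
       bj_orthogonal_sets (max_norm_set T) (min_norm_set T)"
    and u: "norm u = 1" and v: "norm v = 1"
  obtains A :: "'a \<Rightarrow>\<^sub>L 'a" where "blinfun_apply A u = v" "\<And>z. norm (blinfun_apply A z) = norm z"
proof -
  have "u \<noteq> 0" "v \<noteq> 0" using u v by auto
  then obtain w f g y h k where c: "plane_coords u w f g" and c': "plane_coords v y h k"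
    using ex_plane_coords[OF dim] by metis
  define T where "T p z = (fst p * f z + snd (snd p) * g z) *\<^sub>R v + (fst (snd p) * g z) *\<^sub>R y"
    for p :: "real \<times> real \<times> real" and z
  \<comment> \<open>The sign conditions let a positive product \<open>\<alpha> * \<beta>\<close>
    force both factors to be positive.\<close>
  define S where "S = {p. 0 \<le> fst p \<and> 0 \<le> fst (snd p) \<and> (\<forall>z. norm (T p z) \<le> norm z)}"
  have uw: "f u = 1" "g u = 0" "f w = 0" "g w = 1" using c by (auto simp: plane_coords_def)
  obtain m where m: "0 < m" "\<And>a b. m * norm (a, b) \<le> norm (a *\<^sub>R u + b *\<^sub>R w)"
    using plane_coords_bounded[OF c] by blast
  obtain m' where m': "0 < m'" "\<And>a b. m' * norm (a, b) \<le> norm (a *\<^sub>R v + b *\<^sub>R y)"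
    using plane_coords_bounded[OF c'] by blast
  have S: "compact S"
  proof -
    have "S = {p. 0 \<le> fst p} \<inter> {p. 0 \<le> fst (snd p)} \<inter> (\<Inter>z. {p. norm (T p z) \<le> norm z})"
      by (auto simp: S_def)
    moreover have "closed \<dots>" unfolding T_def
      by (intro closed_Int closed_INT ballI closed_Collect_le continuous_intros)
    moreover have "bounded S"
    proof (rule boundedI)
      fix p assume p: "p \<in> S"
      have Tp: "norm (T p z) \<le> norm z" for z using p by (simp add: S_def)
      \<comment> \<open>Testing the contraction at \<open>u\<close> and at \<open>w\<close> bounds
        the two columns of its matrix.\<close>
      have "m' * norm (fst p, 0::real) \<le> 1" "m' * norm (snd (snd p), fst (snd p)) \<le> norm w"
        using m'(2)[of "fst p" 0] m'(2)[of "snd (snd p)" "fst (snd p)"] Tp[of u] Tp[of w] u v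
        by (auto simp: T_def uw)
      then have "norm (fst p, 0::real) \<le> 1 / m'" "norm (snd (snd p), fst (snd p)) \<le> norm w / m'"
        using m'(1) by (auto simp: field_simps)
      moreover have "norm p \<le> norm (fst p) + norm (snd p)"
        using norm_Pair_le[of "fst p" "snd p"] by simp
      moreover have "norm (snd p) = norm (snd (snd p), fst (snd p))"
        by (simp add: norm_prod_def add.commute)
      ultimately show "norm p \<le> 1 / m' + norm w / m'" by (simp add: norm_Pair)
    qed
    ultimately show ?thesis by (simp add: compact_eq_bounded_closed)
  qed
  \<comment> \<open>The diagonal operator with both entries \<open>e\<close> has norm at most
    \<open>e * (1 + norm y) / m\<close>, which is 1. It makes the maximum positive.\<close>
  define e where "e = m / (1 + norm y)"
  have y0: "1 + norm y > 0" using norm_ge_zero[of y] by linarith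
  have e: "e > 0" using m y0 by (simp add: e_def)
  have "(e, e, 0) \<in> S"
  proof -
    have "norm (T (e, e, 0) z) \<le> norm z" for z
    proof -
      have "norm (T (e, e, 0) z) \<le> norm ((e * f z) *\<^sub>R v) + norm ((e * g z) *\<^sub>R y)"
        using norm_triangle_ineq[of "(e * f z) *\<^sub>R v" "(e * g z) *\<^sub>R y"] by (simp add: T_def)
      also have "\<dots> = e * (\<bar>f z\<bar> + \<bar>g z\<bar> * norm y)"
        using e v by (simp add: abs_mult algebra_simps)
      also have "\<dots> \<le> e * (norm (f z, g z) + norm (f z, g z) * norm y)"
        using e norm_fst_le[of "f z" "g z"] norm_snd_le[of "g z" "f z"]
        by (intro mult_left_mono add_mono mult_right_mono) auto
      also have "\<dots> = (e * (1 + norm y)) * norm (f z, g z)" by (simp add: algebra_simps)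
      also have "e * (1 + norm y) = m" using y0 by (simp add: e_def)
      also have "m * norm (f z, g z) \<le> norm z"
        using m(2)[of "f z" "g z"] plane_coords_expand[OF c] by simp
      finally show ?thesis .
    qed
    then show ?thesis using e by (simp add: S_def)
  qed
  moreover have "continuous_on S (\<lambda>p. fst p * fst (snd p))" by (intro continuous_intros)
  ultimately obtain p where p: "p \<in> S"
    "\<And>q. q \<in> S \<Longrightarrow> fst q * fst (snd q) \<le> fst p * fst (snd p)"
    using continuous_attains_sup[OF S] by blast
  obtain a b d where pd: "p = (a, b, d)" by (cases p)
  have "e * e \<le> a * b" using p(2)[OF \<open>(e, e, 0) \<in> S\<close>] by (simp add: pd)
  then have ab: "a * b > 0" using mult_pos_pos[OF e e] by linarith
  have "a \<ge> 0" "b \<ge> 0" using p(1) by (auto simp: S_def pd)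
  then have a: "a > 0" and b: "b > 0" using ab by (auto simp: zero_less_mult_iff)
  obtain A :: "'a \<Rightarrow>\<^sub>L 'a" where A: "\<And>z. blinfun_apply A z = f z *\<^sub>R (a *\<^sub>R v) + g z *\<^sub>R (d *\<^sub>R v + b *\<^sub>R y)"
    using plane_coords_blinfun[OF c] by blast
  have AT: "blinfun_apply A z = T p z" for z by (simp add: A T_def pd algebra_simps)
  have "norm (blinfun_apply A z) \<le> norm z" for z using p(1) by (simp add: AT S_def)
  then have A1: "norm A \<le> 1" by (intro norm_blinfun_bound) auto
  have Au: "blinfun_apply A u = a *\<^sub>R v" by (simp add: A uw)
  have "max_norm_set A = sphere 0 1"
  proof (rule ccontr)
    assume "max_norm_set A \<noteq> sphere 0 1"
    then obtain x where x: "norm x = 1" "max_norm_set A \<subseteq> {x, - x}"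
      using max_norm_set_dichotomy[OF dim sc H, of A] by blast
    \<comment> \<open>In the basis \<open>u\<close>, \<open>w\<close> the matrix of \<open>K\<close>
      has diagonal \<open>i\<close>, \<open>j\<close> and upper entry \<open>l\<close>. Its
      eigenvalues are 2 and -1/2, and \<open>x\<close> must belong to -1/2: if \<open>x\<close> is
      parallel to \<open>u\<close>, that value is put at \<open>i\<close>; otherwise it is put at
      \<open>j\<close> and \<open>l\<close> solves the remaining equation.\<close>
    have "\<exists>i j l. ((i = 2 \<and> j = - 1 / 2) \<or> (i = - 1 / 2 \<and> j = 2)) \<and>
        i * f x + l * g x = - f x / 2 \<and> j * g x = - g x / (2::real)"
    proof (cases "g x = 0")
      case True
      then show ?thesis by (intro exI[of _ "- 1 / 2"] exI[of _ "2"] exI[of _ "0"]) simp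
    next
      case False
      then show ?thesis
        by (intro exI[of _ 2] exI[of _ "- 1 / 2"] exI[of _ "- 5 / 2 * f x / g x"]) (simp add: field_simps)
    qed
    then obtain i j l :: real where ij: "(i = 2 \<and> j = - 1 / 2) \<or> (i = - 1 / 2 \<and> j = 2)"
      and l: "i * f x + l * g x = - f x / 2" "j * g x = - g x / 2" by blast
    obtain K :: "'a \<Rightarrow>\<^sub>L 'a" where K: "\<And>z. blinfun_apply K z = f z *\<^sub>R (i *\<^sub>R u) + g z *\<^sub>R (l *\<^sub>R u + j *\<^sub>R w)"
      using plane_coords_blinfun[OF c] by blast
    have K': "blinfun_apply K z = (i * f z + l * g z) *\<^sub>R u + (j * g z) *\<^sub>R w" for z
      by (simp add: K algebra_simps)
    have "blinfun_apply K x = (- 1 / 2) *\<^sub>R (f x *\<^sub>R u + g x *\<^sub>R w)"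
      unfolding K' l by (simp add: scaleR_add_right)
    then have "x + blinfun_apply K x = (1 / 2) *\<^sub>R x"
      unfolding plane_coords_expand[OF c] using scaleR_left_distrib[of 1 "- 1 / 2" x] by simp
    then have "norm (x + blinfun_apply K x) < 1" using x(1) by simp
    from perturb_norm_le_1[OF dim A1 x(2) this]
    obtain t where t: "0 < t" "t \<le> 1" "\<And>z. norm (blinfun_apply A (z + t *\<^sub>R blinfun_apply K z)) \<le> norm z"
      by blast
    \<comment> \<open>The triple encoding \<open>A\<close> composed with \<open>I + t K\<close>; the
      composition keeps this form because \<open>K\<close> is upper triangular.\<close>
    define q where "q = (a * (1 + t * i), b * (1 + t * j), a * t * l + d * (1 + t * j))"
    have "blinfun_apply A (z + t *\<^sub>R blinfun_apply K z) = T q z" for z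
    proof -
      have "f z *\<^sub>R u + g z *\<^sub>R w + t *\<^sub>R blinfun_apply K z
          = (f z + t * (i * f z + l * g z)) *\<^sub>R u + (g z + t * (j * g z)) *\<^sub>R w"
        by (simp add: K' algebra_simps)
      then have zK: "z + t *\<^sub>R blinfun_apply K z
          = (f z + t * (i * f z + l * g z)) *\<^sub>R u + (g z + t * (j * g z)) *\<^sub>R w"
        by (simp add: plane_coords_expand[OF c])
      show ?thesis unfolding zK A plane_coords_lincomb[OF c]
        by (simp add: T_def q_def algebra_simps)
    qed
    moreover have "1 + t * i \<ge> 0" "1 + t * j \<ge> 0" using ij t by auto
    ultimately have "q \<in> S" using t(3) a b by (simp add: S_def q_def)
    then have "(a * b) * ((1 + t * i) * (1 + t * j)) \<le> (a * b) * 1"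
      using p(2)[of q] by (simp add: q_def pd mult_ac)
    then have "(1 + t * i) * (1 + t * j) \<le> 1" using ab by (simp only: mult_le_cancel_left_pos)
    \<comment> \<open>This is the determinant of \<open>I + t K\<close>: the trace 3/2 outweighs the
      determinant -1 of \<open>K\<close> because \<open>t \<le> 1\<close>.\<close>
    moreover have "(1 + t * i) * (1 + t * j) = 1 + t * (3 / 2 - t)" using ij by (auto simp: algebra_simps)
    moreover have "t * (3 / 2 - t) > 0" using t by simp
    ultimately show False by linarith
  qed
  then have "z \<in> max_norm_set A" if "norm z = 1" for z
    using that by simp
  then have M: "norm (blinfun_apply A z) = norm A" if "norm z = 1" for z
    using that unfolding max_norm_set_def by blast
  have nA: "norm A = a" using M[OF u] Au a v by simp
  have iso: "norm (blinfun_apply A z) = a * norm z" for z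
  proof (cases "z = 0")
    case False
    then have "norm (blinfun_apply A (sgn z)) = a" using M nA by (simp add: norm_sgn)
    then show ?thesis using False by (simp add: sgn_div_norm blinfun.scaleR_right field_simps)
  qed simp
  show thesis
  proof (rule that)
    show "blinfun_apply ((1 / a) *\<^sub>R A) u = v" using a by (simp add: blinfun.scaleR_left Au)
    show "norm (blinfun_apply ((1 / a) *\<^sub>R A) z) = norm z" for z
      using a iso[of z] by (simp add: blinfun.scaleR_left)
  qed
qed

section \<open>The Loewner ellipse and its invariance\<close>

text \<open>The triple \<open>(a, b, c)\<close> stands for the form \<open>a f\<^sup>2 + 2 b f g + c g\<^sup>2\<close>; its unit ball contains that
  of the norm, and the form of largest determinant \<open>a c - b\<^sup>2\<close> gives the Loewner ellipse.\<close>
definition dominated_forms :: "('a::real_normed_vector \<Rightarrow> real) \<Rightarrow> ('a \<Rightarrow> real) \<Rightarrow> (real \<times> real \<times> real) set" where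
  "dominated_forms f g = {(a, b, c). 0 \<le> a \<and> 0 \<le> c \<and> b\<^sup>2 \<le> a * c \<and>
     (\<forall>z. a * (f z)\<^sup>2 + 2 * b * f z * g z + c * (g z)\<^sup>2 \<le> (norm z)\<^sup>2)}"

text \<open>Testing at \<open>u\<close> and \<open>w\<close> bounds the diagonal coefficients, and
  \<open>b\<^sup>2 \<le> a * c\<close> then bounds the mixed one.\<close>

lemma compact_dominated_forms:
  assumes c: "plane_coords u w f g"
  shows "compact (dominated_forms f g)"
proof -
  have "dominated_forms f g = {p. 0 \<le> fst p} \<inter> {p. 0 \<le> snd (snd p)}
      \<inter> {p. (fst (snd p))\<^sup>2 \<le> fst p * snd (snd p)}
      \<inter> (\<Inter>z. {p. fst p * (f z)\<^sup>2 + 2 * fst (snd p) * f z * g z + snd (snd p) * (g z)\<^sup>2 \<le> (norm z)\<^sup>2})"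
    by (auto simp: dominated_forms_def)
  moreover have "closed \<dots>"
    by (intro closed_Int closed_INT ballI closed_Collect_le continuous_intros)
  ultimately have "closed (dominated_forms f g)" by simp
  moreover have "bounded (dominated_forms f g)"
  proof -
    define A where "A = (norm u)\<^sup>2"
    define C where "C = (norm w)\<^sup>2"
    have uw: "f u = 1" "g u = 0" "f w = 0" "g w = 1" using c by (auto simp: plane_coords_def)
    have "dominated_forms f g \<subseteq> {0..A} \<times> {- (1 + A * C)..1 + A * C} \<times> {0..C}"
    proof (clarsimp simp: dominated_forms_def)
      fix a b c
      assume a: "0 \<le> a" "0 \<le> c" "b\<^sup>2 \<le> a * c"
        "\<forall>z. a * (f z)\<^sup>2 + 2 * b * f z * g z + c * (g z)\<^sup>2 \<le> (norm z)\<^sup>2"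
      have aA: "a \<le> A" using a(4)[rule_format, of u] by (simp add: uw A_def)
      have cC: "c \<le> C" using a(4)[rule_format, of w] by (simp add: uw C_def)
      have "b\<^sup>2 \<le> A * C" using a aA cC mult_mono[OF aA cC] by linarith
      moreover have "\<bar>b\<bar> \<le> 1 + b\<^sup>2"
        using zero_le_power2[of "\<bar>b\<bar> - 1"] zero_le_power2[of b] unfolding power2_diff by simp
      ultimately show "a \<le> A \<and> - 1 - A * C \<le> b \<and> b \<le> 1 + A * C \<and> c \<le> C" using aA cC by auto
    qed
    moreover have "bounded ({0..A} \<times> {- (1 + A * C)..1 + A * C} \<times> {0..C})"
      by (intro bounded_Times bounded_closed_interval)
    ultimately show ?thesis by (rule bounded_subset[rotated])
  qed
  ultimately show ?thesis by (simp add: compact_eq_bounded_closed)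
qed

text \<open>The determinant attains its maximum by compactness. A small Euclidean form, with both
  diagonal entries \<open>m\<^sup>2\<close>, shows that the maximum is positive.\<close>

lemma ex_max_dominated_form:
  assumes c: "plane_coords u w f g"
  obtains a b c where "(a, b, c) \<in> dominated_forms f g" "0 < a * c - b\<^sup>2"
    "\<And>a' b' c'. (a', b', c') \<in> dominated_forms f g \<Longrightarrow> a' * c' - b'\<^sup>2 \<le> a * c - b\<^sup>2"
proof -
  obtain m where m: "0 < m" "\<And>a b. m * norm (a, b) \<le> norm (a *\<^sub>R u + b *\<^sub>R w)"
    using plane_coords_bounded[OF c] by blast
  have "m\<^sup>2 * ((f z)\<^sup>2 + (g z)\<^sup>2) \<le> (norm z)\<^sup>2" for z
  proof -
    have "m * norm (f z, g z) \<le> norm z" using m(2)[of "f z" "g z"] plane_coords_expand[OF c] by simp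
    then have "(m * norm (f z, g z))\<^sup>2 \<le> (norm z)\<^sup>2" using m(1) by (intro power_mono) auto
    then show ?thesis by (simp add: power_mult_distrib norm_Pair)
  qed
  then have 1: "(m\<^sup>2, 0, m\<^sup>2) \<in> dominated_forms f g"
    by (simp add: dominated_forms_def algebra_simps)
  have "continuous_on (dominated_forms f g) (\<lambda>p. fst p * snd (snd p) - (fst (snd p))\<^sup>2)"
    by (intro continuous_intros)
  then obtain p where p: "p \<in> dominated_forms f g"
    "\<And>q. q \<in> dominated_forms f g \<Longrightarrow>
       fst q * snd (snd q) - (fst (snd q))\<^sup>2 \<le> fst p * snd (snd p) - (fst (snd p))\<^sup>2"
    using continuous_attains_sup[OF compact_dominated_forms[OF c]] 1 by blast
  show thesis
  proof (rule that)
    show "(fst p, fst (snd p), snd (snd p)) \<in> dominated_forms f g" using p(1) by simp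
    show "0 < fst p * snd (snd p) - (fst (snd p))\<^sup>2" using m(1)
      by (intro less_le_trans[OF _ p(2)[OF 1]]) simp
    show "a' * c' - b'\<^sup>2 \<le> fst p * snd (snd p) - (fst (snd p))\<^sup>2"
      if "(a', b', c') \<in> dominated_forms f g" for a' b' c' using p(2)[OF that] by simp
  qed
qed

text \<open>The midpoint of two maximisers is again dominated, and unless they coincide its
  determinant would exceed theirs.\<close>

lemma max_dominated_form_unique:
  assumes p: "(a, b, c) \<in> dominated_forms f g" "0 < a * c - b\<^sup>2"
    and max: "\<And>a' b' c'. (a', b', c') \<in> dominated_forms f g \<Longrightarrow> a' * c' - b'\<^sup>2 \<le> a * c - b\<^sup>2"
    and q: "(a', b', c') \<in> dominated_forms f g" "a' * c' - b'\<^sup>2 = a * c - b\<^sup>2"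
  shows "a' = a" "b' = b" "c' = c"
proof -
  define D where "D = a * c - b\<^sup>2"
  have D: "D > 0" "a * c = D + b\<^sup>2" "a' * c' = D + b'\<^sup>2" using p q by (auto simp: D_def)
  have nn: "a \<ge> 0" "a' \<ge> 0" "c \<ge> 0" "c' \<ge> 0" using p(1) q(1) by (auto simp: dominated_forms_def)
  have "a * c > 0" "a' * c' > 0" using D zero_le_power2[of b] zero_le_power2[of b'] by linarith+
  then have pos: "a > 0" "a' > 0" using nn by (auto simp: zero_less_mult_iff)
  \<comment> \<open>strict log-concavity of the determinant, tested at the midpoint\<close>
  have mid: "a * c' + a' * c - 2 * b * b' \<le> 2 * D"
  proof (cases "0 \<le> a * c' + a' * c - 2 * b * b'")
    \<comment> \<open>The midpoint has determinant
      \<open>(2 * D + (a * c' + a' * c - 2 * b * b')) / 4\<close>, so it is admissible when the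
      mixed term is nonnegative; a negative one meets the bound trivially.\<close>
    case True
    then have "((b + b') / 2)\<^sup>2 \<le> (a + a') / 2 * ((c + c') / 2)"
      using D by (simp add: power2_eq_square field_simps)
    moreover have "(a + a') / 2 * (f z)\<^sup>2 + 2 * ((b + b') / 2) * f z * g z + (c + c') / 2 * (g z)\<^sup>2
        \<le> (norm z)\<^sup>2" for z
    proof -
      have "a * (f z)\<^sup>2 + 2 * b * f z * g z + c * (g z)\<^sup>2 \<le> (norm z)\<^sup>2"
        "a' * (f z)\<^sup>2 + 2 * b' * f z * g z + c' * (g z)\<^sup>2 \<le> (norm z)\<^sup>2"
        using p(1) q(1) by (auto simp: dominated_forms_def)
      then show ?thesis by (simp add: field_simps)
    qed
    moreover have "0 \<le> (a + a') / 2" "0 \<le> (c + c') / 2" using nn by simp_all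
    ultimately have "((a + a') / 2, (b + b') / 2, (c + c') / 2) \<in> dominated_forms f g"
      unfolding dominated_forms_def by blast
    then have "(a + a') / 2 * ((c + c') / 2) - ((b + b') / 2)\<^sup>2 \<le> D"
      unfolding D_def by (rule max)
    then show ?thesis using D(2,3) by (simp add: power2_eq_square field_simps)
  qed (use D in auto)
  \<comment> \<open>Multiplying by \<open>a * a'\<close> allows \<open>c\<close> and
    \<open>c'\<close> to be eliminated through the determinants, which leaves a sum of
    squares.\<close>
  have "a * a' * (a * c' + a' * c - 2 * b * b') \<le> a * a' * (2 * D)"
    using mid pos by (intro mult_left_mono) auto
  moreover have "a * a' * (a * c' + a' * c - 2 * b * b') = a\<^sup>2 * (a' * c') + a'\<^sup>2 * (a * c) - 2 * b * b' * a * a'"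
    by (simp add: power2_eq_square algebra_simps)
  ultimately have "D * (a - a')\<^sup>2 + (a * b' - a' * b)\<^sup>2 \<le> 0"
    unfolding D by (simp add: power2_eq_square algebra_simps)
  moreover have "D * (a - a')\<^sup>2 \<ge> 0" "(a * b' - a' * b)\<^sup>2 \<ge> 0" using D by auto
  ultimately have "D * (a - a')\<^sup>2 = 0" "(a * b' - a' * b)\<^sup>2 = 0" by linarith+
  then show 1: "a' = a" and 2: "b' = b" using D pos by auto
  have "a * c' = a * c" using D(2,3) 1 2 by simp
  then show "c' = c" using pos by simp
qed

text \<open>The new triple is the pullback of the form along the contraction with columns
  \<open>(p, r)\<close> and \<open>(s, t)\<close>. Its determinant is the old one times
  \<open>(p * t - r * s)\<^sup>2\<close>.\<close>

lemma dominated_forms_compose: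
  assumes c: "plane_coords u w f g"
    and q: "(a, b, c) \<in> dominated_forms f g"
    and le: "\<And>\<alpha> \<beta>. norm ((p * \<alpha> + s * \<beta>) *\<^sub>R u + (r * \<alpha> + t * \<beta>) *\<^sub>R w) \<le> norm (\<alpha> *\<^sub>R u + \<beta> *\<^sub>R w)"
  shows "(a * p\<^sup>2 + 2 * b * p * r + c * r\<^sup>2, a * p * s + b * (p * t + r * s) + c * r * t,
      a * s\<^sup>2 + 2 * b * s * t + c * t\<^sup>2) \<in> dominated_forms f g" (is "(?a, ?b, ?c) \<in> _")
proof -
  have nn: "0 \<le> a" "0 \<le> c" "b\<^sup>2 \<le> a * c" using q by (auto simp: dominated_forms_def)
  have psd: "0 \<le> a * x\<^sup>2 + 2 * b * x * y + c * y\<^sup>2" for x y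
  proof (cases "a = 0")
    case True
    then have "b = 0" using nn by simp
    then show ?thesis using nn True by simp
  next
    case False
    \<comment> \<open>Completing the square.\<close>
    have "a * (a * x\<^sup>2 + 2 * b * x * y + c * y\<^sup>2) = (a * x + b * y)\<^sup>2 + (a * c - b\<^sup>2) * y\<^sup>2"
      by (simp add: power2_eq_square algebra_simps)
    also have "\<dots> \<ge> 0" using nn by simp
    finally show ?thesis using False nn by (simp add: zero_le_mult_iff)
  qed
  have "?a * ?c - ?b\<^sup>2 = (p * t - r * s)\<^sup>2 * (a * c - b\<^sup>2)"
    by (simp add: power2_eq_square algebra_simps)
  also have "\<dots> \<ge> 0" using nn by simp
  finally have "?b\<^sup>2 \<le> ?a * ?c" by simp
  moreover have "?a * (f z)\<^sup>2 + 2 * ?b * f z * g z + ?c * (g z)\<^sup>2 \<le> (norm z)\<^sup>2" for z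
  proof -
    define y where "y = (p * f z + s * g z) *\<^sub>R u + (r * f z + t * g z) *\<^sub>R w"
    have fg: "f y = p * f z + s * g z" "g y = r * f z + t * g z"
      unfolding y_def by (simp_all add: plane_coords_lincomb[OF c])
    have "?a * (f z)\<^sup>2 + 2 * ?b * f z * g z + ?c * (g z)\<^sup>2 = a * (f y)\<^sup>2 + 2 * b * f y * g y + c * (g y)\<^sup>2"
      unfolding fg by (simp add: power2_eq_square algebra_simps)
    also have "\<dots> \<le> (norm y)\<^sup>2" using q by (auto simp: dominated_forms_def)
    also have "\<dots> \<le> (norm z)\<^sup>2"
      using le[of "f z" "g z"] plane_coords_expand[OF c, of z] by (intro power_mono) (simp_all add: y_def)
    finally show ?thesis .
  qed
  ultimately show ?thesis using psd[of p r] psd[of s t] by (simp add: dominated_forms_def)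
qed

text \<open>Pulling back along \<open>A\<close> and along its inverse cannot raise the maximal
  determinant, so \<open>A\<close> has determinant 1 or -1. The pullback along \<open>A\<close> is
  then a maximiser too, and uniqueness gives it the same leading coefficient, which is the value at
  \<open>u\<close>.\<close>

lemma max_dominated_form_isometry_invariant:
  fixes A :: "'a::real_normed_vector \<Rightarrow>\<^sub>L 'a"
  assumes co: "plane_coords u w f g"
    and q: "(a, b, c) \<in> dominated_forms f g" "0 < a * c - b\<^sup>2"
    and max: "\<And>a' b' c'. (a', b', c') \<in> dominated_forms f g \<Longrightarrow> a' * c' - b'\<^sup>2 \<le> a * c - b\<^sup>2"
    and iso: "\<And>z. norm (blinfun_apply A z) = norm z"
  shows "a * (f (A u))\<^sup>2 + 2 * b * f (A u) * g (A u) + c * (g (A u))\<^sup>2 = a"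
proof -
  define p r s t where defs: "p = f (A u)" "r = g (A u)" "s = f (A w)" "t = g (A w)"
  define D where "D = a * c - b\<^sup>2"
  have D: "D > 0" using q by (simp add: D_def)
  have Au: "A u = p *\<^sub>R u + r *\<^sub>R w" and Aw: "A w = s *\<^sub>R u + t *\<^sub>R w"
    unfolding defs by (simp_all add: plane_coords_expand[OF co])
  have Alin: "A (\<alpha> *\<^sub>R u + \<beta> *\<^sub>R w) = (p * \<alpha> + s * \<beta>) *\<^sub>R u + (r * \<alpha> + t * \<beta>) *\<^sub>R w" for \<alpha> \<beta>
    by (simp add: blinfun.add_right blinfun.scaleR_right Au Aw algebra_simps)
  have norm_eq: "norm ((p * \<alpha> + s * \<beta>) *\<^sub>R u + (r * \<alpha> + t * \<beta>) *\<^sub>R w) = norm (\<alpha> *\<^sub>R u + \<beta> *\<^sub>R w)" for \<alpha> \<beta>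
    unfolding Alin[symmetric] by (rule iso)
  have inj: "\<alpha> = 0 \<and> \<beta> = 0" if "p * \<alpha> + s * \<beta> = 0" "r * \<alpha> + t * \<beta> = 0" for \<alpha> \<beta>
  proof -
    have "\<alpha> *\<^sub>R u + \<beta> *\<^sub>R w = 0" using norm_eq[of \<alpha> \<beta>] that by simp
    then show ?thesis
      using plane_coords_lincomb[OF co, of \<alpha> \<beta>] plane_coords_lincomb[OF co, of 0 0] by simp
  qed
  define d where "d = p * t - r * s"
  have d: "d \<noteq> 0"
  proof
    assume "d = 0"
    \<comment> \<open>The columns of the adjugate lie in the kernel of a singular matrix, so
      injectivity makes every entry vanish.\<close>
    then have "t = 0 \<and> - r = 0" "- s = 0 \<and> p = 0"
      by (intro inj; simp add: d_def algebra_simps)+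
    then show False using inj[of 1 1] by simp
  qed
  have det: "(a * x\<^sup>2 + 2 * b * x * y + c * y\<^sup>2) * (a * x'\<^sup>2 + 2 * b * x' * y' + c * y'\<^sup>2)
      - (a * x * x' + b * (x * y' + y * x') + c * y * y')\<^sup>2 = (x * y' - y * x')\<^sup>2 * D" for x y x' y' :: real
    unfolding D_def by (simp add: power2_eq_square algebra_simps)
  \<comment> \<open>the inverse of \<open>A\<close> is an isometry too, which forces \<open>d\<^sup>2 = 1\<close>\<close>
  have le': "norm ((t / d * \<alpha> + (- s / d) * \<beta>) *\<^sub>R u + ((- r / d) * \<alpha> + p / d * \<beta>) *\<^sub>R w)
      \<le> norm (\<alpha> *\<^sub>R u + \<beta> *\<^sub>R w)" for \<alpha> \<beta>
  proof -
    define x where "x = t / d * \<alpha> + (- s / d) * \<beta>"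
    define y where "y = (- r / d) * \<alpha> + p / d * \<beta>"
    have "p * x + s * y = (p * t - r * s) * \<alpha> / d" "r * x + t * y = (p * t - r * s) * \<beta> / d"
      unfolding x_def y_def using d by (simp_all add: field_simps)
    then have "p * x + s * y = \<alpha>" "r * x + t * y = \<beta>" using d by (simp_all add: d_def)
    then show ?thesis using norm_eq[of x y] unfolding x_def y_def by simp
  qed
  note q1 = dominated_forms_compose[OF co q(1) eq_refl[OF norm_eq]]
  note q2 = dominated_forms_compose[OF co q(1) le']
  have "d\<^sup>2 * D \<le> 1 * D"
    using max[OF q1] det[of p r s t] by (simp add: d_def D_def)
  then have 1: "d\<^sup>2 \<le> 1" using D by (simp only: mult_le_cancel_right_pos)
  have "(t / d * (p / d) - (- r / d) * (- s / d))\<^sup>2 * D \<le> 1 * D"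
    using max[OF q2] det[of "t / d" "- r / d" "- s / d" "p / d"] by (simp add: D_def)
  then have "(t / d * (p / d) - (- r / d) * (- s / d))\<^sup>2 \<le> 1" using D by (simp only: mult_le_cancel_right_pos)
  moreover have "t / d * (p / d) - (- r / d) * (- s / d) = (p * t - r * s) / (d * d)"
    by (simp add: diff_divide_distrib mult.commute)
  ultimately have "(1 / d)\<^sup>2 \<le> 1" using d by (simp flip: d_def)
  then have "1 \<le> d\<^sup>2" using d by (simp add: power_divide)
  with 1 have "d\<^sup>2 = 1" by simp
  then have "(p * t - r * s)\<^sup>2 * D = D" by (simp add: d_def)
  then have "a * p\<^sup>2 + 2 * b * p * r + c * r\<^sup>2 = a"
    using max_dominated_form_unique(1)[OF q max q1] det[of p r s t] by (simp add: D_def)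
  then show ?thesis by (simp add: defs)
qed

section \<open>From transitive isometries to an inner product\<close>

lemma transitive_isometries_imp_inner_product_space:
  assumes dim: "dim (UNIV :: 'a::real_normed_vector set) = 2"
    and iso: "\<And>u v :: 'a. norm u = 1 \<Longrightarrow> norm v = 1 \<Longrightarrow>
      \<exists>A :: 'a \<Rightarrow>\<^sub>L 'a. blinfun_apply A u = v \<and> (\<forall>z. norm (blinfun_apply A z) = norm z)"
  shows "inner_product_space TYPE('a)"
proof -
  obtain u :: 'a where u: "norm u = 1" using compact_unit_sphere_plane(2)[OF dim] by auto
  then have "u \<noteq> 0" by auto
  then obtain w f g where co: "plane_coords u w f g" using ex_plane_coords[OF dim] by blast
  obtain a b c where q: "(a, b, c) \<in> dominated_forms f g" "0 < a * c - b\<^sup>2"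
    and max: "\<And>a' b' c'. (a', b', c') \<in> dominated_forms f g \<Longrightarrow> a' * c' - b'\<^sup>2 \<le> a * c - b\<^sup>2"
    using ex_max_dominated_form[OF co] by blast
  have lin: "linear f" "linear g" using co by (auto simp: plane_coords_def)
  have a: "a > 0"
  proof -
    have "a \<ge> 0" using q(1) by (simp add: dominated_forms_def)
    moreover have "a * c > 0" using q(2) zero_le_power2[of b] by linarith
    ultimately show ?thesis by (cases "a = 0") auto
  qed
  have unit: "a * (f v)\<^sup>2 + 2 * b * f v * g v + c * (g v)\<^sup>2 = a" if v: "norm v = 1" for v
  proof -
    obtain A :: "'a \<Rightarrow>\<^sub>L 'a" where A: "blinfun_apply A u = v" "\<And>z. norm (blinfun_apply A z) = norm z"
      using iso[OF u v] by blast
    show ?thesis using max_dominated_form_isometry_invariant[OF co q max A(2)] A(1) by simp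
  qed
  \<comment> \<open>The polarised maximal form, divided by its constant value \<open>a\<close> on
    the unit sphere; homogeneity then yields the squared norm everywhere.\<close>
  define ip where "ip x y = (a * f x * f y + b * (f x * g y + g x * f y) + c * g x * g y) / a" for x y
  have ip_norm: "ip z z = (norm z)\<^sup>2" for z
  proof (cases "z = 0")
    case True
    then show ?thesis using lin by (simp add: ip_def linear_0)
  next
    case False
    define v where "v = sgn z"
    have v: "norm v = 1" "z = norm z *\<^sub>R v" using False by (simp_all add: v_def norm_sgn sgn_div_norm)
    have "f z = norm z * f v" "g z = norm z * g v"
      using lin v(2) linear_scale[of _ "norm z" v] by (metis real_scaleR_def)+
    then have "ip z z = (norm z)\<^sup>2 * ((a * (f v)\<^sup>2 + 2 * b * f v * g v + c * (g v)\<^sup>2) / a)"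
      by (simp add: ip_def power2_eq_square algebra_simps)
    then show ?thesis using unit[OF v(1)] a by simp
  qed
  have "bilinear ip" unfolding bilinear_def ip_def
    by (auto intro!: linearI simp: linear_add[OF lin(1)] linear_add[OF lin(2)]
        linear_scale[OF lin(1)] linear_scale[OF lin(2)] algebra_simps add_divide_distrib)
  moreover have "ip x y = ip y x" for x y by (simp add: ip_def algebra_simps)
  ultimately have "inner_product_on ip" by (simp add: inner_product_on_def ip_norm)
  moreover have "norm z = sqrt (ip z z)" for z by (simp add: ip_norm)
  ultimately show ?thesis unfolding inner_product_space_def by blast
qed

theorem theorem3p5:
  assumes "dim (UNIV :: 'a::banach set) = 2"
    and "strictly_convex_space TYPE('a)"
  shows "inner_product_space TYPE('a) \<longleftrightarrow>
    (\<forall>T :: 'a \<Rightarrow>\<^sub>L 'a.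
       (max_norm_set T = sphere 0 1 \<and> min_norm_set T = sphere 0 1) \<or>
       (bj_orthogonal_sets (max_norm_set T) (min_norm_set T) \<and>
        bj_orthogonal_sets (min_norm_set T) (max_norm_set T)))" (is "?L \<longleftrightarrow> ?R")
proof
  assume ?L
  then show ?R using inner_product_space_imp_orthogonal_sets by blast
next
  assume ?R
  then have "max_norm_set T = sphere 0 1 \<or> bj_orthogonal_sets (max_norm_set T) (min_norm_set T)"
    for T :: "'a \<Rightarrow>\<^sub>L 'a" by blast
  from ex_isometry_between_unit_vectors[OF assms this]
  show ?L by (intro transitive_isometries_imp_inner_product_space[OF assms(1)]) metis
qed

end
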